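(* Let $n$ be a positive integer, let $R$ be a ring and let $I$ be a proper ideal of $R$. If $I$ has an $n$-OA-factorization, then the set $\mathrm{Min}(I)$ of prime ideals of $R$ minimal over $I$ is finite.
   Context: All rings are commutative with $1\neq 0$. A proper ideal $I$ of a ring $R$ is an $n$-OA ideal if whenever $a_1a_2\cdots a_{n+1}\in I$ for nonunits $a_1,\ldots,a_{n+1}\in R$, then $a_1a_2\cdots a_n\in I$ or $a_{n+1}\in I$. An $n$-OA-factorization of an ideal $I$ is an expression $I=\prod_{i=1}^m I_i$ of $I$ as a product of finitely many $n$-OA ideals $I_i$ of $R$. $\mathrm{Min}(I)$ denotes the set of prime ideals of $R$ that are minimal over $I$. *)

theory Defs
  imports "HOL-Algebra.Algebra"
begin

text \<open>
  The conventions ``commutative with \<open>1 \<noteq> 0\<close>'' and ``\<open>n\<close> positive'' are not built into the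
  definitions; they are hypotheses wherever these are used.  \<open>Units R\<close> is the set of
  multiplicative units of \<open>R\<close>.
\<close>

definition n_OA_ideal :: "nat \<Rightarrow> ('a, 'b) ring_scheme \<Rightarrow> 'a set \<Rightarrow> bool"
  where "n_OA_ideal n R I \<longleftrightarrow>
    ideal I R \<and> I \<noteq> carrier R \<and>
    (\<forall>a \<in> {1..n + 1} \<rightarrow> carrier R - Units R.
       (\<Otimes>\<^bsub>R\<^esub>i\<in>{1..n + 1}. a i) \<in> I \<longrightarrow>
       (\<Otimes>\<^bsub>R\<^esub>i\<in>{1..n}. a i) \<in> I \<or> a (n + 1) \<in> I)"

text \<open>
  The product of ideals is the iterated product in the commutative monoid \<open>ideals_set R\<close>, whose
  multiplication is \<open>ideal_prod R\<close> and whose unit is \<open>carrier R\<close>.  Factorizations are nonempty.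
\<close>

definition has_n_OA_factorization :: "nat \<Rightarrow> ('a, 'b) ring_scheme \<Rightarrow> 'a set \<Rightarrow> bool"
  where "has_n_OA_factorization n R I \<longleftrightarrow>
    (\<exists>(m::nat) J. m \<ge> 1 \<and> (\<forall>i \<in> {1..m}. n_OA_ideal n R (J i)) \<and>
       I = (\<Otimes>\<^bsub>ideals_set R\<^esub>i\<in>{1..m}. J i))"

definition minimal_primes_over :: "('a, 'b) ring_scheme \<Rightarrow> 'a set \<Rightarrow> 'a set set"
  where "minimal_primes_over R I =
    {P. primeideal P R \<and> I \<subseteq> P \<and> (\<forall>Q. primeideal Q R \<and> I \<subseteq> Q \<and> Q \<subseteq> P \<longrightarrow> Q = P)}"

end

theory Submission
  imports Defs
begin

text \<open>
  An \<open>n\<close>-OA ideal has a prime radical: if a power of \<open>x \<otimes> y\<close> lies in it, the \<open>n\<close>-OA condition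
  applies to \<open>n\<close> copies of a power of \<open>x\<close> followed by one power of \<open>y\<close>
  (lemma \<open>n_OA_radical_prime\<close>).  Let \<open>I\<close> be the product of the \<open>n\<close>-OA ideals
  \<open>J 1, \<dots>, J m\<close>, and let \<open>P\<close> be a prime ideal containing \<open>I\<close>.  Then \<open>P\<close> contains some
  \<open>J i\<close>, hence the radical of \<open>J i\<close>.  That radical is itself a prime ideal containing \<open>I\<close>, so it
  equals \<open>P\<close> as soon as \<open>P\<close> is minimal over \<open>I\<close>.  Thus \<open>I\<close> has at most \<open>m\<close> minimal primes.
\<close>

definition ideal_radical :: "('a, 'b) ring_scheme \<Rightarrow> 'a set \<Rightarrow> 'a set"
  where "ideal_radical R I = {x \<in> carrier R. \<exists>k::nat. x [^]\<^bsub>R\<^esub> k \<in> I}"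

text \<open>
  This replaces the binomial theorem in showing that the radical is closed under addition.  The
  extra factor \<open>z\<close> lets the induction on \<open>k + l\<close> split off one factor \<open>x \<oplus> y\<close> of the power and
  absorb either summand into \<open>z\<close>.
\<close>

lemma (in cring) mult_add_pow_in_ideal:
  assumes "ideal I R" "x \<in> carrier R" "y \<in> carrier R" "z \<in> carrier R"
    and "z \<otimes> x [^] (k::nat) \<in> I" "z \<otimes> y [^] (l::nat) \<in> I"
  shows "z \<otimes> (x \<oplus> y) [^] (k + l) \<in> I"
  using assms(4-6)
proof (induction "k + l" arbitrary: k l z)
  case 0
  then show ?case by simp
next
  case (Suc N)
  interpret I: ideal I R by fact
  note xy = assms(2,3) Suc.prems(1)
  show ?case
  proof (cases "k = 0 \<or> l = 0")
    case True
    then have "z \<in> I" using Suc.prems by auto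
    then show ?thesis by (simp add: I.I_r_closed xy)
  next
    case False
    then obtain k' l' where kl: "k = Suc k'" "l = Suc l'"
      by (meson not0_implies_Suc)
    have "z \<otimes> x \<otimes> x [^] k' \<in> I" "z \<otimes> y \<otimes> y [^] l' \<in> I"
      using Suc.prems(2,3) xy by (simp_all add: kl m_ac)
    moreover have "z \<otimes> x \<otimes> y [^] l \<in> I" "z \<otimes> y \<otimes> x [^] k \<in> I"
      using I.I_l_closed[OF Suc.prems(3) xy(1)] I.I_l_closed[OF Suc.prems(2) xy(2)] xy
      by (simp_all add: m_ac)
    ultimately have "z \<otimes> x \<otimes> (x \<oplus> y) [^] (k' + l) \<in> I" "z \<otimes> y \<otimes> (x \<oplus> y) [^] (k + l') \<in> I"
      using Suc.hyps(1)[of k' l "z \<otimes> x"] Suc.hyps(1)[of k l' "z \<otimes> y"] Suc.hyps(2) xy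
      by (auto simp: kl)
    then have "z \<otimes> x \<otimes> (x \<oplus> y) [^] N \<oplus> z \<otimes> y \<otimes> (x \<oplus> y) [^] N \<in> I"
      using Suc.hyps(2) by (auto simp: kl intro: I.a_closed)
    moreover have "z \<otimes> x \<otimes> (x \<oplus> y) [^] N \<oplus> z \<otimes> y \<otimes> (x \<oplus> y) [^] N
        = z \<otimes> (x \<oplus> y) [^] Suc N"
      using xy by (simp add: m_ac l_distr r_distr)
    ultimately show ?thesis using Suc.hyps(2) by simp
  qed
qed

lemma (in cring) ideal_radical_is_ideal:
  assumes "ideal I R"
  shows "ideal (ideal_radical R I) R"
proof (rule idealI)
  interpret I: ideal I R by fact
  have mult: "a \<otimes> x \<in> ideal_radical R I" if "a \<in> ideal_radical R I" "x \<in> carrier R" for a x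
    using that by (auto simp: ideal_radical_def nat_pow_distrib intro: I.I_r_closed)
  then show "a \<otimes> x \<in> ideal_radical R I" if "a \<in> ideal_radical R I" "x \<in> carrier R" for a x
    using that .
  show "x \<otimes> a \<in> ideal_radical R I" if "a \<in> ideal_radical R I" "x \<in> carrier R" for a x
    using mult[OF that] that by (simp add: m_comm ideal_radical_def)
  show "subgroup (ideal_radical R I) (add_monoid R)"
  proof (rule add.subgroupI)
    show "ideal_radical R I \<subseteq> carrier R"
      by (auto simp: ideal_radical_def)
    have "\<zero> [^] (1::nat) \<in> I" by (simp add: I.zero_closed)
    then show "ideal_radical R I \<noteq> {}"
      unfolding ideal_radical_def by blast
    show "\<ominus> a \<in> ideal_radical R I" if "a \<in> ideal_radical R I" for a
      using mult[OF that, of "\<ominus> \<one>"] that by (simp add: ideal_radical_def r_minus)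
    show "a \<oplus> b \<in> ideal_radical R I"
      if ab: "a \<in> ideal_radical R I" "b \<in> ideal_radical R I" for a b
    proof -
      from ab obtain k l :: nat where
        carr: "a \<in> carrier R" "b \<in> carrier R" and kl: "a [^] k \<in> I" "b [^] l \<in> I"
        by (auto simp: ideal_radical_def)
      from kl carr have "(a \<oplus> b) [^] (k + l) \<in> I"
        using mult_add_pow_in_ideal[OF assms carr one_closed, of k l] by simp
      with carr show ?thesis
        unfolding ideal_radical_def by blast
    qed
  qed
qed (rule ring_axioms)

lemma (in cring) subset_ideal_radical:
  assumes "ideal I R"
  shows "I \<subseteq> ideal_radical R I"
proof
  fix x assume "x \<in> I"
  moreover from this have "x \<in> carrier R" using ideal.Icarr[OF assms] by blast
  ultimately have "x \<in> carrier R" "x [^] (1::nat) \<in> I" by simp_all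
  then show "x \<in> ideal_radical R I" unfolding ideal_radical_def by blast
qed

lemma (in primeideal) ideal_radical_subset:
  assumes "J \<subseteq> I"
  shows "ideal_radical R J \<subseteq> I"
proof
  fix x assume "x \<in> ideal_radical R J"
  then obtain k :: nat where x: "x \<in> carrier R" and k: "x [^] k \<in> I"
    using assms by (auto simp: ideal_radical_def)
  from k show "x \<in> I"
  proof (induction k)
    case 0
    then show ?case using one_imp_carrier I_notcarr by simp
  next
    case (Suc k)
    then show ?case using I_prime[of "x [^] k" x] x by auto
  qed
qed

text \<open>
  Units are harmless: if \<open>x\<close> is a unit, a power of \<open>x \<otimes> y\<close> in \<open>I\<close> can be divided by the power
  of \<open>x\<close>.  For nonunits, \<open>x [^] k \<otimes> y [^] k \<in> I\<close> gives \<open>(x [^] k) [^] n \<otimes> y [^] k \<in> I\<close>, a product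
  of \<open>n + 1\<close> nonunits as \<open>k > 0\<close>, and either alternative of the \<open>n\<close>-OA condition is a power of \<open>x\<close> or of
  \<open>y\<close>.
\<close>

lemma (in cring) n_OA_radical_prime:
  assumes "n_OA_ideal n R I" "n \<ge> 1"
  shows "primeideal (ideal_radical R I) R"
proof (rule primeidealI)
  have idl: "ideal I R" and proper: "I \<noteq> carrier R"
    using assms(1) by (auto simp: n_OA_ideal_def)
  interpret I: ideal I R by (rule idl)
  have one: "\<one> \<notin> I" using I.one_imp_carrier proper by blast
  show "ideal (ideal_radical R I) R" by (rule ideal_radical_is_ideal[OF idl])
  show "cring R" by (rule is_cring)
  have "\<one> \<notin> ideal_radical R I" using one by (simp add: ideal_radical_def)
  then show "carrier R \<noteq> ideal_radical R I" by blast
  have unit_case: "v \<in> ideal_radical R I"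
    if "u \<in> Units R" "v \<in> carrier R" "u [^] k \<otimes> v [^] k \<in> I" for u v and k :: nat
  proof -
    have u: "u [^] k \<in> Units R" using that by (simp add: Units_pow_closed)
    have "inv (u [^] k) \<otimes> (u [^] k \<otimes> v [^] k) \<in> I"
      using I.I_l_closed[OF that(3)] u by simp
    also have "inv (u [^] k) \<otimes> (u [^] k \<otimes> v [^] k) = v [^] k"
      using u that(2) by (simp add: m_assoc[symmetric] Units_closed)
    finally show ?thesis using that(2) by (auto simp: ideal_radical_def)
  qed
  fix x y assume xy: "x \<in> carrier R" "y \<in> carrier R" and "x \<otimes> y \<in> ideal_radical R I"
  then obtain k :: nat where k: "x [^] k \<otimes> y [^] k \<in> I"
    by (auto simp: ideal_radical_def nat_pow_distrib)
  show "x \<in> ideal_radical R I \<or> y \<in> ideal_radical R I"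
  proof (cases "x \<in> Units R \<or> y \<in> Units R")
    case True
    then show ?thesis
      using unit_case[of x y k] unit_case[of y x k] k xy by (auto simp: m_comm)
  next
    case False
    have "k \<noteq> 0" using k one by (cases k) auto
    then obtain k' where k': "k = Suc k'" by (meson not0_implies_Suc)
    have nonunit: "v [^] k \<in> carrier R - Units R" if "v \<in> carrier R" "v \<notin> Units R" for v
      using that unit_factor[of "v" "v [^] k'"] by (auto simp: k' m_comm)
    define a where "a i = (if i \<le> n then x [^] k else y [^] k)" for i
    have a: "a \<in> {1..n + 1} \<rightarrow> carrier R - Units R"
      using nonunit False xy by (auto simp: a_def)
    have prod_n: "(\<Otimes>i\<in>{1..n}. a i) = (x [^] k) [^] n"
    proof -
      have "(\<Otimes>i\<in>{1..n}. a i) = (\<Otimes>i\<in>{1..n}. x [^] k)"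
        using xy by (intro finprod_cong') (auto simp: a_def)
      then show ?thesis using xy by (simp add: finprod_const)
    qed
    have oa: "(\<Otimes>i\<in>{1..n}. a i) \<in> I \<or> a (n + 1) \<in> I"
      if "(\<Otimes>i\<in>{1..n + 1}. a i) \<in> I"
      using assms(1) a that unfolding n_OA_ideal_def by blast
    have "{1..n + 1} = insert (n + 1) {1..n}" by auto
    then have prod: "(\<Otimes>i\<in>{1..n + 1}. a i) = y [^] k \<otimes> (x [^] k) [^] n"
      using a prod_n by (simp add: Pi_def a_def)
    \<comment> \<open>One of the \<open>n\<close> powers of \<open>x\<close> is needed to absorb \<open>y [^] k\<close> into \<open>I\<close>.\<close>
    from \<open>n \<ge> 1\<close> obtain m where n: "n = Suc m" by (cases n) auto
    have "(x [^] k) [^] m \<otimes> (x [^] k \<otimes> y [^] k) \<in> I"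
      using I.I_l_closed[OF k] xy by simp
    then have "(\<Otimes>i\<in>{1..n + 1}. a i) \<in> I"
      using xy by (subst prod) (simp add: n m_ac)
    from oa[OF this] have "x [^] (k * n) \<in> I \<or> y [^] k \<in> I"
      using xy unfolding prod_n by (auto simp: a_def nat_pow_pow)
    then show ?thesis using xy by (auto simp: ideal_radical_def)
  qed
qed

lemma (in cring) finprod_ideals_subset:
  assumes "finite A" "\<And>i. i \<in> A \<Longrightarrow> ideal (J i) R" "i \<in> A"
  shows "(\<Otimes>\<^bsub>ideals_set R\<^esub>i\<in>A. J i) \<subseteq> J i"
proof -
  interpret S: comm_monoid "ideals_set R" by (rule ideals_set_is_comm_monoid)
  have J: "J \<in> B \<rightarrow> carrier (ideals_set R)" if "B \<subseteq> A" for B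
    using assms(2) that by (auto simp: ideals_set_def)
  have "ideal (\<Otimes>\<^bsub>ideals_set R\<^esub>j\<in>A - {i}. J j) R"
    using S.finprod_closed[OF J[of "A - {i}"]] by (simp add: ideals_set_def)
  moreover have "(\<Otimes>\<^bsub>ideals_set R\<^esub>j\<in>insert i (A - {i}). J j)
      = J i \<cdot> (\<Otimes>\<^bsub>ideals_set R\<^esub>j\<in>A - {i}. J j)"
    using S.finprod_insert[of "A - {i}" i J] assms J[of "A - {i}"]
    by (auto simp: ideals_set_def)
  ultimately show ?thesis
    using ideal_prod_inter[of "J i"] assms by (auto simp: insert_absorb)
qed

lemma (in cring) prime_contains_finprod_ideals:
  assumes "primeideal P R" "finite A" "\<And>i. i \<in> A \<Longrightarrow> ideal (J i) R"
    and "(\<Otimes>\<^bsub>ideals_set R\<^esub>i\<in>A. J i) \<subseteq> P"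
  obtains i where "i \<in> A" "J i \<subseteq> P"
proof -
  interpret S: comm_monoid "ideals_set R" by (rule ideals_set_is_comm_monoid)
  interpret P: primeideal P R by fact
  have "\<exists>i\<in>A. J i \<subseteq> P"
    using assms(2-4)
  proof (induction A)
    case empty
    have "(\<Otimes>\<^bsub>ideals_set R\<^esub>i\<in>{}. J i) = carrier R"
      unfolding S.finprod_empty by (simp add: ideals_set_def)
    with empty have "carrier R \<subseteq> P" by simp
    then show ?case using P.I_notcarr P.a_subset by blast
  next
    case (insert i A)
    have J: "J \<in> A \<rightarrow> carrier (ideals_set R)" "J i \<in> carrier (ideals_set R)"
      using insert.prems(1) by (auto simp: ideals_set_def)
    have "ideal (\<Otimes>\<^bsub>ideals_set R\<^esub>j\<in>A. J j) R"
      using S.finprod_closed[OF J(1)] by (simp add: ideals_set_def)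
    moreover have "J i \<cdot> (\<Otimes>\<^bsub>ideals_set R\<^esub>j\<in>A. J j) \<subseteq> P"
      using insert.prems(2) S.finprod_insert[OF insert.hyps J] by (simp add: ideals_set_def)
    ultimately have "J i \<subseteq> P \<or> (\<Otimes>\<^bsub>ideals_set R\<^esub>j\<in>A. J j) \<subseteq> P"
      using primeideal_divides_ideal_prod[OF assms(1)] insert.prems(1) by blast
    then show ?case using insert.IH insert.prems(1) by blast
  qed
  with that show ?thesis by blast
qed

theorem proposition2p3:
  fixes R :: "('a, 'b) ring_scheme" and n :: nat and I :: "'a set"
  assumes "n \<ge> 1"
    and "cring R" and "\<one>\<^bsub>R\<^esub> \<noteq> \<zero>\<^bsub>R\<^esub>"
    and "ideal I R" and "I \<noteq> carrier R"
    and "has_n_OA_factorization n R I"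
  shows "finite (minimal_primes_over R I)"
proof -
  interpret cring R by fact
  from assms(6) obtain m :: nat and J where
    J: "\<And>i. i \<in> {1..m} \<Longrightarrow> n_OA_ideal n R (J i)"
    and I: "I = (\<Otimes>\<^bsub>ideals_set R\<^esub>i\<in>{1..m}. J i)"
    unfolding has_n_OA_factorization_def by blast
  have J_ideal: "ideal (J i) R" if "i \<in> {1..m}" for i
    using J[OF that] by (simp add: n_OA_ideal_def)
  have "minimal_primes_over R I \<subseteq> (\<lambda>i. ideal_radical R (J i)) ` {1..m}"
  proof
    fix P assume "P \<in> minimal_primes_over R I"
    then have P: "primeideal P R" "I \<subseteq> P"
      and min: "\<And>Q. primeideal Q R \<Longrightarrow> I \<subseteq> Q \<Longrightarrow> Q \<subseteq> P \<Longrightarrow> Q = P"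
      by (auto simp: minimal_primes_over_def)
    obtain i where i: "i \<in> {1..m}" "J i \<subseteq> P"
      using prime_contains_finprod_ideals[OF P(1) finite_atLeastAtMost J_ideal P(2)[unfolded I]]
      by metis
    have "I \<subseteq> ideal_radical R (J i)"
      using finprod_ideals_subset[of "{1..m}" J i] J_ideal i(1) subset_ideal_radical[OF J_ideal[OF i(1)]]
      unfolding I by auto
    then have "ideal_radical R (J i) = P"
      by (intro min n_OA_radical_prime[OF J[OF i(1)] assms(1)]
          primeideal.ideal_radical_subset[OF P(1) i(2)])
    with i(1) show "P \<in> (\<lambda>i. ideal_radical R (J i)) ` {1..m}" by blast
  qed
  then show ?thesis by (rule finite_subset) simp
qed

end
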